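(* Let $\Lambda$ be a finitely aligned $k$-graph. Then there is a finitely aligned $k$-graph $\widetilde\Lambda$ with no sources, and an embedding (injective $k$-graph morphism) $\iota$ of $\Lambda$ in $\widetilde\Lambda$. If $\Lambda$ is row-finite, then so is $\widetilde\Lambda$.
   Context: Conventions: $\mathbb N=\{0,1,2,\dots\}$; $\mathbb N^k$ is ordered coordinatewise, and $\vee$ is the coordinatewise maximum. A $k$-graph is a countable category $\Lambda$ with a functor $d:\Lambda\to\mathbb N^k$ (degree) satisfying the factorisation property: whenever $d(\lambda)=m+n$ there are unique $\mu,\nu$ with $\lambda=\mu\nu$, $d(\mu)=m$, $d(\nu)=n$. Here $\lambda\in\Lambda$ means $\lambda$ is a morphism, $r,s$ are codomain and domain ($\lambda\mu$ is defined iff $s(\lambda)=r(\mu)$). $\Lambda^n=d^{-1}(n)$, $\Lambda^0$ is identified with the objects (vertices), and $v\Lambda^n=\{\lambda\in\Lambda^n: r(\lambda)=v\}$. A $k$-graph morphism is a degree-preserving functor. $\Lambda$ is row-finite if $v\Lambda^n$ is finite for all $v\in\Lambda^0$, $n\in\mathbb N^k$; it has no sources if $v\Lambda^n\ne\emptyset$ for all $v\in\Lambda^0$, $n\in\mathbb N^k$. $\Lambda$ is finitely aligned if for all $\mu,\nu\in\Lambda$ the set $\mathrm{MCE}(\mu,\nu)$ of $\lambda\in\Lambda$ with $\lambda=\mu\alpha=\nu\beta$ for some $\alpha,\beta\in\Lambda$ and $d(\lambda)=d(\mu)\vee d(\nu)$ is finite (possibly empty). *)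

theory Defs
  imports "HOL-Library.Function_Algebras" "HOL-Library.Countable_Set"
begin

text \<open>The monoid of \<open>k\<close>-tuples of natural numbers is represented by the functions
  \<open>nat \<Rightarrow> nat\<close> vanishing outside the coordinates \<open>0, \<dots>, k - 1\<close>, so that \<open>k\<close> is an
  arbitrary natural number. Addition, zero, the order and \<open>sup\<close> on functions are pointwise,
  hence coordinatewise.\<close>

definition Nk :: "nat \<Rightarrow> (nat \<Rightarrow> nat) set" where
  "Nk k = {m. \<forall>i\<ge>k. m i = 0}"

text \<open>The functions \<open>src\<close> and \<open>rng\<close> give the domain and the codomain of a morphism, and
  \<open>comp C f g\<close> is the composite \<open>fg\<close> (first \<open>g\<close>, then \<open>f\<close>). All operations are total
  functions on the underlying types and are meaningful only on the carrier sets \<open>Obj\<close> and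
  \<open>Mor\<close>; \<open>comp C f g\<close> moreover only if \<open>src C f = rng C g\<close>.\<close>

record ('o, 'm) cat =
  Obj :: "'o set"
  Mor :: "'m set"
  src :: "'m \<Rightarrow> 'o"
  rng :: "'m \<Rightarrow> 'o"
  ident :: "'o \<Rightarrow> 'm"
  comp :: "'m \<Rightarrow> 'm \<Rightarrow> 'm"

locale category =
  fixes C :: "('o, 'm, 'x) cat_scheme"
  assumes src_in_Obj: "f \<in> Mor C \<Longrightarrow> src C f \<in> Obj C"
    and rng_in_Obj: "f \<in> Mor C \<Longrightarrow> rng C f \<in> Obj C"
    and ident_in_Mor: "v \<in> Obj C \<Longrightarrow> ident C v \<in> Mor C"
    and src_ident: "v \<in> Obj C \<Longrightarrow> src C (ident C v) = v"
    and rng_ident: "v \<in> Obj C \<Longrightarrow> rng C (ident C v) = v"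
    and comp_in_Mor: "\<lbrakk>f \<in> Mor C; g \<in> Mor C; src C f = rng C g\<rbrakk> \<Longrightarrow> comp C f g \<in> Mor C"
    and src_comp: "\<lbrakk>f \<in> Mor C; g \<in> Mor C; src C f = rng C g\<rbrakk> \<Longrightarrow> src C (comp C f g) = src C g"
    and rng_comp: "\<lbrakk>f \<in> Mor C; g \<in> Mor C; src C f = rng C g\<rbrakk> \<Longrightarrow> rng C (comp C f g) = rng C f"
    and comp_assoc: "\<lbrakk>f \<in> Mor C; g \<in> Mor C; h \<in> Mor C; src C f = rng C g; src C g = rng C h\<rbrakk>
      \<Longrightarrow> comp C (comp C f g) h = comp C f (comp C g h)"
    and comp_ident_left: "f \<in> Mor C \<Longrightarrow> comp C (ident C (rng C f)) f = f"
    and comp_ident_right: "f \<in> Mor C \<Longrightarrow> comp C f (ident C (src C f)) = f"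

locale cat_functor = source: category C + target: category D
  for C :: "('o, 'm, 'x) cat_scheme" and D :: "('p, 'n, 'y) cat_scheme" +
  fixes F0 :: "'o \<Rightarrow> 'p" and F :: "'m \<Rightarrow> 'n"
  assumes map_Obj: "v \<in> Obj C \<Longrightarrow> F0 v \<in> Obj D"
    and map_Mor: "f \<in> Mor C \<Longrightarrow> F f \<in> Mor D"
    and map_src: "f \<in> Mor C \<Longrightarrow> src D (F f) = F0 (src C f)"
    and map_rng: "f \<in> Mor C \<Longrightarrow> rng D (F f) = F0 (rng C f)"
    and map_ident: "v \<in> Obj C \<Longrightarrow> F (ident C v) = ident D (F0 v)"
    and map_comp: "\<lbrakk>f \<in> Mor C; g \<in> Mor C; src C f = rng C g\<rbrakk>
      \<Longrightarrow> F (comp C f g) = comp D (F f) (F g)"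

record ('o, 'm) kgraph = "('o, 'm) cat" +
  deg :: "'m \<Rightarrow> nat \<Rightarrow> nat"

text \<open>Countability of the set of objects follows from \<open>countable_Mor\<close>, since \<open>ident\<close> is
  injective on objects.\<close>

locale k_graph = category L for k :: nat and L :: "('o, 'm) kgraph" +
  assumes countable_Mor: "countable (Mor L)"
    and deg_in_Nk: "l \<in> Mor L \<Longrightarrow> deg L l \<in> Nk k"
    and deg_ident: "v \<in> Obj L \<Longrightarrow> deg L (ident L v) = 0"
    and deg_comp: "\<lbrakk>l \<in> Mor L; l' \<in> Mor L; src L l = rng L l'\<rbrakk>
      \<Longrightarrow> deg L (comp L l l') = deg L l + deg L l'"
    and factorisation: "\<lbrakk>l \<in> Mor L; m \<in> Nk k; n \<in> Nk k; deg L l = m + n\<rbrakk>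
      \<Longrightarrow> \<exists>!p. case p of (\<mu>, \<nu>) \<Rightarrow> \<mu> \<in> Mor L \<and> \<nu> \<in> Mor L \<and> src L \<mu> = rng L \<nu> \<and>
                 l = comp L \<mu> \<nu> \<and> deg L \<mu> = m \<and> deg L \<nu> = n"

text \<open>The set of morphisms of degree \<open>n\<close> with codomain \<open>v\<close>. Vertices are taken to be the
  objects themselves rather than the morphisms of degree zero.\<close>

definition paths_to :: "('o, 'm) kgraph \<Rightarrow> 'o \<Rightarrow> (nat \<Rightarrow> nat) \<Rightarrow> 'm set" where
  "paths_to L v n = {l \<in> Mor L. rng L l = v \<and> deg L l = n}"

definition row_finite :: "nat \<Rightarrow> ('o, 'm) kgraph \<Rightarrow> bool" where
  "row_finite k L \<longleftrightarrow> (\<forall>v\<in>Obj L. \<forall>n\<in>Nk k. finite (paths_to L v n))"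

definition no_sources :: "nat \<Rightarrow> ('o, 'm) kgraph \<Rightarrow> bool" where
  "no_sources k L \<longleftrightarrow> (\<forall>v\<in>Obj L. \<forall>n\<in>Nk k. paths_to L v n \<noteq> {})"

definition MCE :: "('o, 'm) kgraph \<Rightarrow> 'm \<Rightarrow> 'm \<Rightarrow> 'm set" where
  "MCE L \<mu> \<nu> = {l \<in> Mor L. deg L l = sup (deg L \<mu>) (deg L \<nu>) \<and>
     (\<exists>\<alpha>\<in>Mor L. \<exists>\<beta>\<in>Mor L. src L \<mu> = rng L \<alpha> \<and> src L \<nu> = rng L \<beta> \<and>
        l = comp L \<mu> \<alpha> \<and> l = comp L \<nu> \<beta>)}"

definition finitely_aligned :: "('o, 'm) kgraph \<Rightarrow> bool" where
  "finitely_aligned L \<longleftrightarrow> (\<forall>\<mu>\<in>Mor L. \<forall>\<nu>\<in>Mor L. finite (MCE L \<mu> \<nu>))"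

locale k_graph_morphism = source: k_graph k L + target: k_graph k M + cat_functor L M F0 F
  for k :: nat and L :: "('o, 'm) kgraph" and M :: "('p, 'n) kgraph"
    and F0 :: "'o \<Rightarrow> 'p" and F :: "'m \<Rightarrow> 'n" +
  assumes map_deg: "l \<in> Mor L \<Longrightarrow> deg M (F l) = deg L l"

locale k_graph_embedding = k_graph_morphism k L M F0 F
  for k :: nat and L :: "('o, 'm) kgraph" and M :: "('p, 'n) kgraph"
    and F0 :: "'o \<Rightarrow> 'p" and F :: "'m \<Rightarrow> 'n" +
  assumes inj_Obj: "inj_on F0 (Obj L)"
    and inj_Mor: "inj_on F (Mor L)"

end

theory Submission imports Defs begin

text \<open>Attach to every vertex \<open>v\<close> a free copy of the grid \<open>\<nat>\<^sup>k\<close>: its points are the objects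
  \<open>(v, p)\<close>, where \<open>p\<close> records how far one has left the original graph in each direction. A
  morphism \<open>(\<lambda>, p, q)\<close> from \<open>(s(\<lambda>), q)\<close> to \<open>(r(\<lambda>), p)\<close> follows \<open>\<lambda>\<close> and then moves from \<open>p\<close> to
  \<open>q\<close>; directions in which the graph has already been left at \<open>p\<close> must not occur in \<open>\<lambda>\<close>. In each
  coordinate a morphism thus first uses up the degree of \<open>\<lambda>\<close> and then moves in the grid, which forces
  the way in which it factorises. For the same reason a minimal common extension lies over a
  minimal common extension in the original graph and is determined by it.\<close>

definition attach_grids :: "nat \<Rightarrow> ('o, 'm) kgraph \<Rightarrow>
    ('o \<times> (nat \<Rightarrow> nat), 'm \<times> (nat \<Rightarrow> nat) \<times> (nat \<Rightarrow> nat)) kgraph" where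
  "attach_grids k L =
    \<lparr>Obj = Obj L \<times> Nk k,
     Mor = {(l, p, q). l \<in> Mor L \<and> p \<in> Nk k \<and> q \<in> Nk k \<and> p \<le> q \<and> (\<forall>i. p i = 0 \<or> deg L l i = 0)},
     src = (\<lambda>(l, p, q). (src L l, q)),
     rng = (\<lambda>(l, p, q). (rng L l, p)),
     ident = (\<lambda>(v, p). (ident L v, p, p)),
     comp = (\<lambda>(l, p, q) (l', p', q'). (comp L l l', p, q')),
     deg = (\<lambda>(l, p, q) i. deg L l i + (q i - p i))\<rparr>"

lemma attach_grids_simps [simp]:
  "Obj (attach_grids k L) = Obj L \<times> Nk k"
  "(l, p, q) \<in> Mor (attach_grids k L) \<longleftrightarrow>
    l \<in> Mor L \<and> p \<in> Nk k \<and> q \<in> Nk k \<and> p \<le> q \<and> (\<forall>i. p i = 0 \<or> deg L l i = 0)"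
  "src (attach_grids k L) (l, p, q) = (src L l, q)"
  "rng (attach_grids k L) (l, p, q) = (rng L l, p)"
  "ident (attach_grids k L) (v, p) = (ident L v, p, p)"
  "comp (attach_grids k L) (l, p, q) (l', p', q') = (comp L l l', p, q')"
  "deg (attach_grids k L) (l, p, q) = (\<lambda>i. deg L l i + (q i - p i))"
  by (simp_all add: attach_grids_def)

section \<open>Countability and finiteness in the monoid of degrees\<close>

text \<open>Coordinates from \<open>k\<close> on vanish, so an element is determined by a list of
  \<open>k\<close> numbers.\<close>

lemma countable_Nk: "countable (Nk k)"
proof (rule countable_image_inj_on)
  show "inj_on (\<lambda>m. map m [0..<k]) (Nk k)"
  proof (rule inj_onI, rule ext)
    fix m n i assume *: "m \<in> Nk k" "n \<in> Nk k" "map m [0..<k] = map n [0..<k]"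
    then show "m i = n i"
      by (cases "i < k") (auto simp: Nk_def)
  qed
qed simp

lemma finite_Nk_atMost: "finite {m \<in> Nk k. m \<le> n}"
proof -
  \<comment> \<open>\<open>sum n {..<k}\<close> serves as one bound common to all
    coordinates.\<close>
  have "{m \<in> Nk k. m \<le> n} \<subseteq> {m. \<forall>i. (i \<in> {..<k} \<longrightarrow> m i \<in> {..sum n {..<k}}) \<and> (i \<notin> {..<k} \<longrightarrow> m i = 0)}"
    by (auto simp: Nk_def le_fun_def intro: order.trans member_le_sum)
  then show ?thesis
    by (rule finite_subset) (intro finite_set_of_finite_funs finite_lessThan finite_atMost)
qed

section \<open>The grid extension as a k-graph containing the given one\<close>

lemma (in k_graph) category_attach_grids: "category (attach_grids k L)"
proof
  fix f g
  assume "f \<in> Mor (attach_grids k L)" "g \<in> Mor (attach_grids k L)"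
    and "src (attach_grids k L) f = rng (attach_grids k L) g"
  moreover obtain l p q where "f = (l, p, q)" by (cases f)
  moreover obtain l' p' q' where "g = (l', p', q')" by (cases g)
  ultimately have fg: "f = (l, p, q)" "g = (l', q, q')" "l \<in> Mor L" "l' \<in> Mor L"
      "p \<in> Nk k" "q \<in> Nk k" "q' \<in> Nk k" "p \<le> q" "q \<le> q'" "src L l = rng L l'"
    and l: "p i = 0 \<or> deg L l i = 0" and l': "q i = 0 \<or> deg L l' i = 0" for i
    by simp_all
  \<comment> \<open>If \<open>p i > 0\<close>, then \<open>q i > 0\<close> because
    \<open>p \<le> q\<close>, so both \<open>l\<close> and \<open>l'\<close> have degree 0 at
    \<open>i\<close>.\<close>
  have "p i = 0 \<or> deg L (comp L l l') i = 0" for i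
    using l[of i] l'[of i] le_funD[OF \<open>p \<le> q\<close>, of i] fg by (auto simp: deg_comp)
  then show "comp (attach_grids k L) f g \<in> Mor (attach_grids k L)"
    using fg by (simp add: comp_in_Mor)
qed (auto simp: src_in_Obj rng_in_Obj ident_in_Mor src_ident rng_ident src_comp rng_comp
    comp_assoc comp_ident_left comp_ident_right deg_ident)

lemma (in k_graph) factorisationE:
  assumes "l \<in> Mor L" "m \<in> Nk k" "n \<in> Nk k" "deg L l = m + n"
  obtains \<mu> \<nu> where "\<mu> \<in> Mor L" "\<nu> \<in> Mor L" "src L \<mu> = rng L \<nu>" "l = comp L \<mu> \<nu>" "deg L \<mu> = m" "deg L \<nu> = n"
    and "\<And>\<mu>' \<nu>'. \<lbrakk>\<mu>' \<in> Mor L; \<nu>' \<in> Mor L; src L \<mu>' = rng L \<nu>'; l = comp L \<mu>' \<nu>';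
      deg L \<mu>' = m; deg L \<nu>' = n\<rbrakk> \<Longrightarrow> \<mu>' = \<mu> \<and> \<nu>' = \<nu>"
proof -
  let ?P = "\<lambda>(\<mu>, \<nu>). \<mu> \<in> Mor L \<and> \<nu> \<in> Mor L \<and> src L \<mu> = rng L \<nu> \<and> l = comp L \<mu> \<nu> \<and>
    deg L \<mu> = m \<and> deg L \<nu> = n"
  from factorisation[OF assms] obtain x where x: "?P x" and uniq: "\<And>y. ?P y \<Longrightarrow> y = x"
    by (rule ex1E) blast
  obtain \<mu> \<nu> where x_eq: "x = (\<mu>, \<nu>)" by (cases x)
  show thesis
  proof (rule that)
    fix \<mu>' \<nu>'
    assume "\<mu>' \<in> Mor L" "\<nu>' \<in> Mor L" "src L \<mu>' = rng L \<nu>'" "l = comp L \<mu>' \<nu>'"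
      "deg L \<mu>' = m" "deg L \<nu>' = n"
    then show "\<mu>' = \<mu> \<and> \<nu>' = \<nu>"
      using uniq[of "(\<mu>', \<nu>')"] x_eq by simp
  qed (use x x_eq in simp_all)
qed

text \<open>A grid move of the first factor in direction \<open>i\<close> forbids degree at
  \<open>i\<close> in the second. So the first factor must draw on \<open>l\<close> for as long as
  it can, which fixes where to cut both \<open>l\<close> and the grid path; uniqueness then comes
  from \<open>L\<close>.\<close>

lemma (in k_graph) factorisation_attach_grids:
  assumes f: "f \<in> Mor (attach_grids k L)" and m: "m \<in> Nk k" and n: "n \<in> Nk k"
    and "deg (attach_grids k L) f = m + n"
  shows "\<exists>!x. case x of (\<mu>, \<nu>) \<Rightarrow> \<mu> \<in> Mor (attach_grids k L) \<and> \<nu> \<in> Mor (attach_grids k L) \<and>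
    src (attach_grids k L) \<mu> = rng (attach_grids k L) \<nu> \<and> f = comp (attach_grids k L) \<mu> \<nu> \<and>
    deg (attach_grids k L) \<mu> = m \<and> deg (attach_grids k L) \<nu> = n"
proof -
  obtain l p q where f_eq: "f = (l, p, q)" by (cases f)
  with f have l: "l \<in> Mor L" and p: "p \<in> Nk k" and q: "q \<in> Nk k"
    and pq: "p i \<le> q i" and pl: "p i = 0 \<or> deg L l i = 0" for i
    by (auto simp: le_fun_def)
  have deg_f: "deg L l i + (q i - p i) = m i + n i" for i
    using assms(4) by (simp add: f_eq fun_eq_iff)
  \<comment> \<open>\<open>a\<close> is the share of \<open>m\<close> taken from \<open>l\<close>,
    \<open>b\<close> is what remains of \<open>l\<close>, and \<open>t\<close> is the grid point
    reached once the rest of \<open>m\<close> is spent on grid moves.\<close>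
  define a where "a = (\<lambda>i. min (m i) (deg L l i))"
  define b where "b = (\<lambda>i. deg L l i - a i)"
  define t where "t = (\<lambda>i. p i + (m i - a i))"
  have ab: "a \<in> Nk k" "b \<in> Nk k" "deg L l = a + b"
    using m deg_in_Nk[OF l] by (auto simp: Nk_def a_def b_def)
  from factorisationE[OF l this] obtain \<mu> \<nu> where
    fact: "\<mu> \<in> Mor L" "\<nu> \<in> Mor L" "src L \<mu> = rng L \<nu>" "l = comp L \<mu> \<nu>" "deg L \<mu> = a" "deg L \<nu> = b"
    and uniq: "\<And>\<mu>' \<nu>'. \<lbrakk>\<mu>' \<in> Mor L; \<nu>' \<in> Mor L; src L \<mu>' = rng L \<nu>'; l = comp L \<mu>' \<nu>';
      deg L \<mu>' = a; deg L \<nu>' = b\<rbrakk> \<Longrightarrow> \<mu>' = \<mu> \<and> \<nu>' = \<nu>"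
    by blast
  have t: "t \<in> Nk k" using m p by (auto simp: Nk_def t_def)
  have arith: "p i \<le> t i" "t i \<le> q i" "p i = 0 \<or> a i = 0" "t i = 0 \<or> b i = 0"
    "a i + (t i - p i) = m i" "b i + (q i - t i) = n i" for i
    using pq[of i] pl[of i] deg_f[of i] unfolding t_def a_def b_def by (auto simp: min_def)
  show ?thesis
  proof (rule ex1I[of _ "((\<mu>, p, t), (\<nu>, t, q))"])
    show "case ((\<mu>, p, t), (\<nu>, t, q)) of (\<mu>, \<nu>) \<Rightarrow>
        \<mu> \<in> Mor (attach_grids k L) \<and> \<nu> \<in> Mor (attach_grids k L) \<and>
        src (attach_grids k L) \<mu> = rng (attach_grids k L) \<nu> \<and> f = comp (attach_grids k L) \<mu> \<nu> \<and>
        deg (attach_grids k L) \<mu> = m \<and> deg (attach_grids k L) \<nu> = n"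
      using fact p q t arith by (auto simp: f_eq le_fun_def)
  next
    fix x
    assume x: "case x of (\<mu>, \<nu>) \<Rightarrow> \<mu> \<in> Mor (attach_grids k L) \<and> \<nu> \<in> Mor (attach_grids k L) \<and>
        src (attach_grids k L) \<mu> = rng (attach_grids k L) \<nu> \<and> f = comp (attach_grids k L) \<mu> \<nu> \<and>
        deg (attach_grids k L) \<mu> = m \<and> deg (attach_grids k L) \<nu> = n"
    obtain \<mu>' p' t' \<nu>' t'' q' where x_eq: "x = ((\<mu>', p', t'), (\<nu>', t'', q'))"
      by (metis surj_pair)
    with x have x': "p' = p" "t'' = t'" "q' = q" "\<mu>' \<in> Mor L" "\<nu>' \<in> Mor L" "src L \<mu>' = rng L \<nu>'"
        "l = comp L \<mu>' \<nu>'"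
      and le: "p i \<le> t' i" and \<nu>': "t' i = 0 \<or> deg L \<nu>' i = 0"
      and deg_\<mu>': "deg L \<mu>' i + (t' i - p i) = m i" for i
      by (auto simp: f_eq le_fun_def)
    have deg_l: "deg L l i = deg L \<mu>' i + deg L \<nu>' i" for i
      using x' by (simp add: deg_comp)
    \<comment> \<open>If \<open>t' i = 0\<close>, then all of \<open>m i\<close> comes from
      \<open>l\<close>; otherwise \<open>\<nu>'\<close> has degree 0 at \<open>i\<close>, and
      \<open>\<mu>'\<close> uses all of \<open>deg L l i\<close>.\<close>
    have "deg L \<mu>' i = a i \<and> deg L \<nu>' i = b i \<and> t' i = t i" for i
      using le[of i] \<nu>'[of i] deg_\<mu>'[of i] deg_l[of i] pl[of i]
      unfolding a_def b_def t_def by (auto simp: min_def)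
    then have "deg L \<mu>' = a" "deg L \<nu>' = b" "t' = t" by auto
    then show "x = ((\<mu>, p, t), (\<nu>, t, q))"
      using uniq[of \<mu>' \<nu>'] x' x_eq by simp
  qed
qed

lemma (in k_graph) k_graph_attach_grids: "k_graph k (attach_grids k L)"
proof (rule k_graph.intro[OF category_attach_grids], unfold_locales)
  have "Mor (attach_grids k L) \<subseteq> Mor L \<times> Nk k \<times> Nk k" by auto
  then show "countable (Mor (attach_grids k L))"
    by (rule countable_subset) (intro countable_SIGMA countable_Mor countable_Nk)
next
  fix f assume "f \<in> Mor (attach_grids k L)"
  then show "deg (attach_grids k L) f \<in> Nk k"
    using deg_in_Nk by (cases f) (auto simp: Nk_def)
next
  fix v assume "v \<in> Obj (attach_grids k L)"
  then show "deg (attach_grids k L) (ident (attach_grids k L) v) = 0"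
    by (cases v) (auto simp: deg_ident)
next
  \<comment> \<open>Truncated subtraction telescopes here only because grid points increase along a
    path.\<close>
  have deg_add: "x + y + (r - p) = x + q - p + (y + r - q)" if "p \<le> q" "q \<le> r" for x y p q r :: nat
    using that by linarith
  fix f g
  assume "f \<in> Mor (attach_grids k L)" "g \<in> Mor (attach_grids k L)"
    "src (attach_grids k L) f = rng (attach_grids k L) g"
  then show "deg (attach_grids k L) (comp (attach_grids k L) f g) =
      deg (attach_grids k L) f + deg (attach_grids k L) g"
    by (cases f; cases g) (auto simp: deg_comp le_fun_def fun_eq_iff intro: deg_add)
qed (rule factorisation_attach_grids)

text \<open>At the grid origin the side condition on morphisms is vacuous, so all of
  \<open>L\<close> survives there.\<close>

lemma (in k_graph) embedding_attach_grids:
  "k_graph_embedding k L (attach_grids k L) (\<lambda>v. (v, 0)) (\<lambda>l. (l, 0, 0))"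
proof -
  interpret G: k_graph k "attach_grids k L" by (rule k_graph_attach_grids)
  show ?thesis
    by unfold_locales (auto simp: Nk_def src_in_Obj rng_in_Obj inj_on_def)
qed

section \<open>Absence of sources, row-finiteness and finite alignment of the extension\<close>

lemma (in k_graph) no_sources_attach_grids: "no_sources k (attach_grids k L)"
  unfolding no_sources_def
proof (intro ballI)
  fix v n assume "v \<in> Obj (attach_grids k L)" "n \<in> Nk k"
  moreover obtain w p where "v = (w, p)" by (cases v)
  \<comment> \<open>The witness stays over \<open>w\<close> and spends the whole degree
    \<open>n\<close> on grid moves.\<close>
  ultimately have "(ident L w, p, p + n) \<in> paths_to (attach_grids k L) v n"
    by (auto simp: paths_to_def ident_in_Mor rng_ident deg_ident Nk_def le_fun_def)
  then show "paths_to (attach_grids k L) v n \<noteq> {}" by blast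
qed

text \<open>The total degree \<open>n\<close> bounds both the degree of the underlying path and the
  length of the grid move, leaving finitely many choices for each.\<close>

lemma (in k_graph) row_finite_attach_grids:
  assumes "row_finite k L"
  shows "row_finite k (attach_grids k L)"
  unfolding row_finite_def
proof (intro ballI)
  fix v n assume v: "v \<in> Obj (attach_grids k L)" and n: "n \<in> Nk k"
  obtain w p where vw: "v = (w, p)" by (cases v)
  let ?S = "\<Union>m\<in>{m \<in> Nk k. m \<le> n}. paths_to L w m"
  have "paths_to (attach_grids k L) v n \<subseteq> ?S \<times> {p} \<times> {q \<in> Nk k. q \<le> p + n}"
  proof
    fix f assume f: "f \<in> paths_to (attach_grids k L) v n"
    obtain l p' q where f_eq: "f = (l, p', q)" by (cases f)
    from f have l: "l \<in> Mor L" "rng L l = w" "p' = p" "q \<in> Nk k"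
      and deg: "deg L l i + (q i - p i) = n i" for i
      by (auto simp: paths_to_def f_eq vw)
    have "deg L l i \<le> n i \<and> q i \<le> p i + n i" for i
      using deg[of i] by linarith
    then have "deg L l \<le> n" "q \<le> p + n" by (auto simp: le_fun_def)
    then show "f \<in> ?S \<times> {p} \<times> {q \<in> Nk k. q \<le> p + n}"
      using l deg_in_Nk by (auto simp: f_eq paths_to_def)
  qed
  moreover have "finite ?S"
    using assms v vw by (intro finite_UN_I finite_Nk_atMost) (auto simp: row_finite_def)
  ultimately show "finite (paths_to (attach_grids k L) v n)"
    by (elim finite_subset) (intro finite_SigmaI finite_Nk_atMost, simp_all)
qed

text \<open>Projecting to \<open>L\<close> sends minimal common extensions to minimal common
  extensions. This is injective on them: the starting point \<open>p\<close> is fixed, and the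
  prescribed degree then determines the end point.\<close>

lemma (in k_graph) finitely_aligned_attach_grids:
  assumes "finitely_aligned L"
  shows "finitely_aligned (attach_grids k L)"
  unfolding finitely_aligned_def
proof (intro ballI)
  fix f g assume f: "f \<in> Mor (attach_grids k L)" and g: "g \<in> Mor (attach_grids k L)"
  obtain l p q where f_eq: "f = (l, p, q)" by (cases f)
  obtain l' p' q' where g_eq: "g = (l', p', q')" by (cases g)
  define D where "D = (\<lambda>i. max (deg L l i + (q i - p i)) (deg L l' i + (q' i - p' i)))"
  \<comment> \<open>\<open>D\<close> is the degree of any minimal common extension of
    \<open>f\<close> and \<open>g\<close>; the part of it not covered by \<open>x\<close> must be
    grid moves.\<close>
  define ext where "ext x = (x, p, \<lambda>i. p i + (D i - deg L x i))" for x
  have "MCE (attach_grids k L) f g \<subseteq> ext ` MCE L l l'"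
  proof
    fix h assume "h \<in> MCE (attach_grids k L) f g"
    then obtain \<alpha> \<beta> where h: "h \<in> Mor (attach_grids k L)" "\<alpha> \<in> Mor (attach_grids k L)"
        "\<beta> \<in> Mor (attach_grids k L)" "src (attach_grids k L) f = rng (attach_grids k L) \<alpha>"
        "src (attach_grids k L) g = rng (attach_grids k L) \<beta>" "h = comp (attach_grids k L) f \<alpha>"
        "h = comp (attach_grids k L) g \<beta>"
        "deg (attach_grids k L) h = sup (deg (attach_grids k L) f) (deg (attach_grids k L) g)"
      unfolding MCE_def by blast
    obtain x p'' t where h_eq: "h = (x, p'', t)" by (cases h)
    obtain a a1 a2 where \<alpha>_eq: "\<alpha> = (a, a1, a2)" by (cases \<alpha>)
    obtain b b1 b2 where \<beta>_eq: "\<beta> = (b, b1, b2)" by (cases \<beta>)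
    note eqs = f_eq g_eq h_eq \<alpha>_eq \<beta>_eq
    have l: "l \<in> Mor L" "l' \<in> Mor L" using f g by (auto simp: eqs)
    have x: "x \<in> Mor L" "a \<in> Mor L" "b \<in> Mor L" "src L l = rng L a" "src L l' = rng L b"
        "x = comp L l a" "x = comp L l' b" "p'' = p" "p' = p"
      using h by (auto simp: eqs)
    have pt: "p i \<le> q i" "p i \<le> q' i" "p i \<le> t i" for i
      using f g h by (auto simp: eqs le_fun_def)
    have deg_x: "deg L x i = deg L l i + deg L a i" "deg L x i = deg L l' i + deg L b i" for i
      using x l deg_comp[of l a] deg_comp[of l' b] by (metis plus_fun_apply)+
    have ab: "q i = 0 \<or> deg L a i = 0" "q' i = 0 \<or> deg L b i = 0" for i
      using h by (auto simp: eqs)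
    have deg_h: "deg L x i + (t i - p i) = D i" for i
      using h(8) x by (simp add: eqs D_def fun_eq_iff sup_nat_def)
    \<comment> \<open>If \<open>a\<close> and \<open>b\<close> both had positive degree at
      \<open>i\<close>, then \<open>q i = q' i = 0\<close>, so \<open>D i\<close> would be the
      maximum of the degrees of \<open>l\<close> and \<open>l'\<close>, which
      \<open>deg L x i\<close> would exceed. Hence one of them has degree 0 there.\<close>
    have deg_x_max: "deg L x i = max (deg L l i) (deg L l' i)" for i
      using deg_x[of i] ab[of i] deg_h[of i] pt[of i] unfolding D_def by auto
    have t: "t = (\<lambda>i. p i + (D i - deg L x i))"
    proof
      show "t i = p i + (D i - deg L x i)" for i
        using deg_h[of i] pt(3)[of i] by linarith
    qed
    have "deg L x = sup (deg L l) (deg L l')"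
      by (auto simp: deg_x_max sup_nat_def)
    then have "x \<in> MCE L l l'"
      unfolding MCE_def using x by blast
    moreover have "h = ext x"
      using h_eq x t by (simp add: ext_def)
    ultimately show "h \<in> ext ` MCE L l l'" by blast
  qed
  moreover have "finite (MCE L l l')"
    using assms f g by (auto simp: finitely_aligned_def f_eq g_eq)
  ultimately show "finite (MCE (attach_grids k L) f g)"
    by (meson finite_imageI finite_subset)
qed

section \<open>Transport of a k-graph along injections of its carriers\<close>

text \<open>The inverses are relative to the carriers, so maps injective only there, such as
  \<open>to_nat_on\<close>, can be used.\<close>

definition relabel :: "('o \<Rightarrow> 'p) \<Rightarrow> ('m \<Rightarrow> 'n) \<Rightarrow> ('o, 'm) kgraph \<Rightarrow> ('p, 'n) kgraph" where
  "relabel a b L =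
    (let a' = inv_into (Obj L) a; b' = inv_into (Mor L) b in
    \<lparr>Obj = a ` Obj L, Mor = b ` Mor L, src = (\<lambda>f. a (src L (b' f))), rng = (\<lambda>f. a (rng L (b' f))),
     ident = (\<lambda>v. b (ident L (a' v))), comp = (\<lambda>f g. b (comp L (b' f) (b' g))),
     deg = (\<lambda>f. deg L (b' f))\<rparr>)"

locale k_graph_relabelling = k_graph k L for k :: nat and L :: "('o, 'm) kgraph" +
  fixes a :: "'o \<Rightarrow> 'p" and b :: "'m \<Rightarrow> 'n"
  assumes inj_a: "inj_on a (Obj L)" and inj_b: "inj_on b (Mor L)"
begin

lemma relabel_simps [simp]:
  "Obj (relabel a b L) = a ` Obj L"
  "Mor (relabel a b L) = b ` Mor L"
  "f \<in> Mor L \<Longrightarrow> src (relabel a b L) (b f) = a (src L f)"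
  "f \<in> Mor L \<Longrightarrow> rng (relabel a b L) (b f) = a (rng L f)"
  "v \<in> Obj L \<Longrightarrow> ident (relabel a b L) (a v) = b (ident L v)"
  "\<lbrakk>f \<in> Mor L; g \<in> Mor L\<rbrakk> \<Longrightarrow> comp (relabel a b L) (b f) (b g) = b (comp L f g)"
  "f \<in> Mor L \<Longrightarrow> deg (relabel a b L) (b f) = deg L f"
  using inj_a inj_b by (simp_all add: relabel_def Let_def)

lemma a_eq_iff [simp]: "\<lbrakk>v \<in> Obj L; w \<in> Obj L\<rbrakk> \<Longrightarrow> a v = a w \<longleftrightarrow> v = w"
  using inj_a by (rule inj_on_eq_iff)

lemma b_eq_iff [simp]: "\<lbrakk>f \<in> Mor L; g \<in> Mor L\<rbrakk> \<Longrightarrow> b f = b g \<longleftrightarrow> f = g"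
  using inj_b by (rule inj_on_eq_iff)

lemmas category_simps [simp] = src_in_Obj rng_in_Obj ident_in_Mor src_ident rng_ident comp_in_Mor
  src_comp rng_comp comp_assoc comp_ident_left comp_ident_right

text \<open>Each axiom is the axiom of \<open>L\<close> read through \<open>a\<close> and
  \<open>b\<close>; only the unique existence in the factorisation property is transported by
  hand.\<close>

lemma k_graph_relabel: "k_graph k (relabel a b L)"
proof
  show "countable (Mor (relabel a b L))" using countable_Mor by simp
next
  fix f m n
  assume "f \<in> Mor (relabel a b L)" "m \<in> Nk k" "n \<in> Nk k" "deg (relabel a b L) f = m + n"
  then obtain l where l: "f = b l" "l \<in> Mor L" "deg L l = m + n" by auto
  from factorisationE[OF this(2) \<open>m \<in> Nk k\<close> \<open>n \<in> Nk k\<close> this(3)] obtain \<mu> \<nu> where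
    fact: "\<mu> \<in> Mor L" "\<nu> \<in> Mor L" "src L \<mu> = rng L \<nu>" "l = comp L \<mu> \<nu>" "deg L \<mu> = m" "deg L \<nu> = n"
    and uniq: "\<And>\<mu>' \<nu>'. \<lbrakk>\<mu>' \<in> Mor L; \<nu>' \<in> Mor L; src L \<mu>' = rng L \<nu>'; l = comp L \<mu>' \<nu>';
      deg L \<mu>' = m; deg L \<nu>' = n\<rbrakk> \<Longrightarrow> \<mu>' = \<mu> \<and> \<nu>' = \<nu>"
    by blast
  show "\<exists>!x. case x of (\<mu>, \<nu>) \<Rightarrow> \<mu> \<in> Mor (relabel a b L) \<and> \<nu> \<in> Mor (relabel a b L) \<and>
    src (relabel a b L) \<mu> = rng (relabel a b L) \<nu> \<and> f = comp (relabel a b L) \<mu> \<nu> \<and>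
    deg (relabel a b L) \<mu> = m \<and> deg (relabel a b L) \<nu> = n"
  proof (rule ex1I[of _ "(b \<mu>, b \<nu>)"])
    fix x
    assume "case x of (\<mu>, \<nu>) \<Rightarrow> \<mu> \<in> Mor (relabel a b L) \<and> \<nu> \<in> Mor (relabel a b L) \<and>
      src (relabel a b L) \<mu> = rng (relabel a b L) \<nu> \<and> f = comp (relabel a b L) \<mu> \<nu> \<and>
      deg (relabel a b L) \<mu> = m \<and> deg (relabel a b L) \<nu> = n"
    then show "x = (b \<mu>, b \<nu>)"
      using l uniq by auto
  qed (use fact l in auto)
qed (auto simp: deg_in_Nk deg_ident deg_comp)

lemma embedding_relabel: "k_graph_embedding k L (relabel a b L) a b"
proof -
  interpret R: k_graph k "relabel a b L" by (rule k_graph_relabel)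
  show ?thesis
    by unfold_locales (auto simp: inj_a inj_b)
qed

lemma paths_to_relabel: "v \<in> Obj L \<Longrightarrow> paths_to (relabel a b L) (a v) n = b ` paths_to L v n"
  by (auto simp: paths_to_def)

lemma no_sources_relabel: "no_sources k L \<Longrightarrow> no_sources k (relabel a b L)"
  by (auto simp: no_sources_def paths_to_relabel)

lemma row_finite_relabel: "row_finite k L \<Longrightarrow> row_finite k (relabel a b L)"
  by (auto simp: row_finite_def paths_to_relabel)

text \<open>The extending morphisms are images under \<open>b\<close>, and injectivity of
  \<open>b\<close> reflects their equations back to \<open>L\<close>. The inclusion is enough to
  pass on finiteness.\<close>

lemma MCE_relabel_subset:
  "\<lbrakk>f \<in> Mor L; g \<in> Mor L\<rbrakk> \<Longrightarrow> MCE (relabel a b L) (b f) (b g) \<subseteq> b ` MCE L f g"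
  by (force simp: MCE_def)

lemma finitely_aligned_relabel: "finitely_aligned L \<Longrightarrow> finitely_aligned (relabel a b L)"
  by (auto simp: finitely_aligned_def intro: finite_subset[OF MCE_relabel_subset])

end

section \<open>Moving the extension to the natural numbers\<close>

lemma (in k_graph) countable_Obj: "countable (Obj L)"
proof (rule countable_subset)
  show "Obj L \<subseteq> src L ` Mor L" by (metis ident_in_Mor image_eqI src_ident subsetI)
qed (simp add: countable_Mor)

lemma k_graph_embedding_comp:
  assumes "k_graph_embedding k L M F0 F" and "k_graph_embedding k M N G0 G"
  shows "k_graph_embedding k L N (G0 \<circ> F0) (G \<circ> F)"
proof -
  interpret F: k_graph_embedding k L M F0 F by fact
  interpret G: k_graph_embedding k M N G0 G by fact
  show ?thesis
  proof unfold_locales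
    show "inj_on (G0 \<circ> F0) (Obj L)"
      using F.inj_Obj G.inj_Obj F.map_Obj by (auto simp: inj_on_def)
    show "inj_on (G \<circ> F) (Mor L)"
      using F.inj_Mor G.inj_Mor F.map_Mor by (auto simp: inj_on_def)
  qed (simp_all add: F.map_Obj G.map_Obj F.map_Mor G.map_Mor F.map_src G.map_src F.map_rng G.map_rng
      F.map_ident G.map_ident F.map_comp G.map_comp F.map_deg G.map_deg)
qed

theorem theorem4p1:
  fixes k :: nat and L :: "('o, 'm) kgraph"
  assumes "k_graph k L" and "finitely_aligned L"
  shows "\<exists>(M :: (nat, nat) kgraph) F0 F.
    k_graph k M \<and> finitely_aligned M \<and> no_sources k M \<and>
    k_graph_embedding k L M F0 F \<and>
    (row_finite k L \<longrightarrow> row_finite k M)"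
proof -
  interpret k_graph k L by fact
  let ?G = "attach_grids k L"
  interpret G: k_graph k ?G by (rule k_graph_attach_grids)
  \<comment> \<open>Countability makes \<open>to_nat_on\<close> injective on both carriers, so the
    extension has a copy with objects and morphisms in \<open>nat\<close>.\<close>
  interpret R: k_graph_relabelling k ?G "to_nat_on (Obj ?G)" "to_nat_on (Mor ?G)"
    by unfold_locales (intro inj_on_to_nat_on G.countable_Obj G.countable_Mor)+
  show ?thesis
    using R.k_graph_relabel R.finitely_aligned_relabel[OF finitely_aligned_attach_grids[OF assms(2)]]
      R.no_sources_relabel[OF no_sources_attach_grids]
      k_graph_embedding_comp[OF embedding_attach_grids R.embedding_relabel]
      R.row_finite_relabel[OF row_finite_attach_grids]
    by blast
qed

end
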